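(* Let $A_1=\{231,312,4321,21543\}$ and $A_2=\{231,321,4123,21534\}$. For all $n\ge 1$, $$|\operatorname{Av}_n(A_1)|=|\operatorname{Av}_n(A_2)|=F_{n+1}-1,$$ where $F_n$ denotes the Fibonacci numbers with $F_0=F_1=1$ and $F_{n}=F_{n-1}+F_{n-2}$.
   Context: For a set $S$ of permutations, $\operatorname{Av}_n(S)$ is the set of permutations of length $n$ that avoid every pattern in $S$ (classical pattern avoidance). *)

theory Defs
  imports
    "HOL-Combinatorics.Multiset_Permutations"
    "HOL-Library.Sublist"
    "HOL-Number_Theory.Fib"
begin

(* Permutations of length n are in one-line notation: the elements of
   permutations_of_set {1..n}, so 231 is the list [2, 3, 1]. *)

definition order_isomorphic :: "nat list \<Rightarrow> nat list \<Rightarrow> bool" where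
  "order_isomorphic xs ys \<longleftrightarrow> length xs = length ys \<and>
     (\<forall>i<length xs. \<forall>j<length xs. xs ! i < xs ! j \<longleftrightarrow> ys ! i < ys ! j)"

(* The subsequence need not be contiguous: subseq is the scattered sublist relation. *)
definition contains_pattern :: "nat list \<Rightarrow> nat list \<Rightarrow> bool" where
  "contains_pattern w p \<longleftrightarrow> (\<exists>zs. subseq zs w \<and> order_isomorphic zs p)"

definition Av :: "nat \<Rightarrow> nat list set \<Rightarrow> nat list set" where
  "Av n S = {w \<in> permutations_of_set {1..n}. \<forall>p\<in>S. \<not> contains_pattern w p}"

(* Indexed so that F 0 = F 1 = 1, unlike the library's fib, which has fib 0 = 0. *)
fun F :: "nat \<Rightarrow> nat" where
  "F 0 = 1"
| "F (Suc 0) = 1"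
| "F (Suc (Suc n)) = F (Suc n) + F n"

lemma F_eq_fib: "F n = fib (Suc n)"
  by (induction n rule: F.induct) auto

(* Hence the natural-number subtraction F n - 1 never truncates. *)
lemma F_pos: "F n \<ge> 1"
  by (induction n rule: F.induct) auto

end

theory Submission
  imports Defs
begin

text \<open>
  In a 231-avoiding permutation \<open>u @ n # v\<close> of \<open>{1..n}\<close>, every entry of \<open>u\<close> is smaller than every
  entry of \<open>v\<close>. In both classes the two patterns of length 3 and the pattern of length 4 leave only
  the possibilities \<open>v = []\<close>, \<open>v = [n - 1]\<close> and one fixed arrangement of \<open>{n - 2, n - 1}\<close>, and in
  the last case the pattern of length 5 forces \<open>u\<close> to be increasing. Nothing else is forbidden, so
  both sequences satisfy \<open>a n = a (n - 1) + a (n - 2) + 1\<close>.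
\<close>

section \<open>Subsequences and order isomorphism\<close>

lemma set_subseq:
  assumes "subseq xs ys"
  shows "set xs \<subseteq> set ys"
  using assms by (metis set_nths_subset subseq_conv_nths)

lemma subseq_distinct:
  assumes "subseq xs ys" "distinct ys"
  shows "distinct xs"
  using assms by (auto simp: subseq_conv_nths)

lemma order_isomorphic_Nil: "order_isomorphic [] []"
  by (simp add: order_isomorphic_def)

text \<open>With \<open>order_isomorphic_Nil\<close> this reduces order isomorphism of explicit
  lists to finitely many comparisons that simp can settle. Both directions of \<open><\<close> occur
  because the definition ranges over ordered pairs of positions.\<close>

lemma order_isomorphic_Cons:
  "order_isomorphic (x # xs) (y # ys) \<longleftrightarrow>
     order_isomorphic xs ys \<and> list_all2 (\<lambda>a b. (x < a \<longleftrightarrow> y < b) \<and> (a < x \<longleftrightarrow> b < y)) xs ys"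
  by (auto simp: order_isomorphic_def list_all2_conv_all_nth All_less_Suc2)

lemma order_isomorphic_nth_less:
  assumes "order_isomorphic zs p" "i < length p" "j < length p"
  shows "zs ! i < zs ! j \<longleftrightarrow> p ! i < p ! j"
  using assms by (auto simp: order_isomorphic_def)

section \<open>Pattern occurrences in a concatenation of small values and large values\<close>

lemma contains_pattern_mono:
  assumes "contains_pattern u p" "subseq u w"
  shows "contains_pattern w p"
  using assms unfolding contains_pattern_def by (meson subseq_order.trans)

lemma contains_patternI:
  assumes "subseq zs w" "order_isomorphic zs p"
  shows "contains_pattern w p"
  using assms by (auto simp: contains_pattern_def)

lemma contains_pattern_length_le:
  assumes "contains_pattern w p"
  shows "length p \<le> length w"
  using assms list_emb_length by (fastforce simp: contains_pattern_def order_isomorphic_def)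

lemma contains_pattern_same_length:
  assumes "contains_pattern w p" "length w = length p"
  shows "order_isomorphic w p"
proof -
  obtain zs where "subseq zs w" "order_isomorphic zs p"
    using assms(1) by (auto simp: contains_pattern_def)
  moreover from this have "zs = w"
    using assms(2) by (auto simp: order_isomorphic_def intro: subseq_same_length)
  ultimately show ?thesis by simp
qed

text \<open>If an occurrence reached into \<open>v\<close>, its last entry would lie in
  \<open>v\<close>. At most two of its entries fit into \<open>v\<close>, so its entry at position
  \<open>i\<close> lies in \<open>u\<close> and is smaller than the last one, against
  \<open>last p < p ! i\<close>.\<close>

lemma contains_pattern_append_short:
  assumes "contains_pattern (u @ v) p" and less: "\<forall>x\<in>set u. \<forall>y\<in>set v. x < y"
    and "length v \<le> 2" and i: "i + 2 < length p" "last p < p ! i"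
  shows "contains_pattern u p"
proof -
  obtain zs where zs: "subseq zs (u @ v)" "order_isomorphic zs p"
    using assms(1) by (auto simp: contains_pattern_def)
  then obtain xs ys where [simp]: "zs = xs @ ys" and sub: "subseq xs u" "subseq ys v"
    by (auto elim: subseq_appendE)
  have len: "length p = length xs + length ys"
    using zs(2) by (simp add: order_isomorphic_def)
  have "ys = []"
  proof (rule ccontr)
    assume "ys \<noteq> []"
    have "length ys \<le> 2"
      using list_emb_length[OF sub(2)] assms(3) by simp
    then have "i < length xs" using i len by linarith
    have "p ! (length p - 1) < p ! i"
      using i by (metis last_conv_nth length_0_conv not_less_zero)
    then have "zs ! (length p - 1) < zs ! i"
      using order_isomorphic_nth_less[OF zs(2), of "length p - 1" i] i by simp
    moreover have "zs ! i \<in> set u"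
      using \<open>i < length xs\<close> set_subseq[OF sub(1)] by (auto simp: nth_append)
    moreover have "zs ! (length p - 1) = last ys"
      using len \<open>ys \<noteq> []\<close> by (metis \<open>zs = xs @ ys\<close> append_is_Nil_conv last_appendR last_conv_nth length_append)
    moreover have "last ys \<in> set v"
      using set_subseq[OF sub(2)] \<open>ys \<noteq> []\<close> by auto
    ultimately show False using less by fastforce
  qed
  then show ?thesis using sub zs by (auto intro: contains_patternI)
qed

text \<open>If an occurrence started in \<open>u\<close>, its first entry would be a minimum: later
  entries in \<open>u\<close> are no smaller because \<open>u\<close> is sorted, and those in
  \<open>v\<close> lie above \<open>u\<close>. The entry at position \<open>j\<close> contradicts
  this, so the whole occurrence lies in \<open>v\<close>.\<close>

lemma contains_pattern_sorted_append:
  assumes "contains_pattern (u @ v) p" and less: "\<forall>x\<in>set u. \<forall>y\<in>set v. x < y"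
    and "sorted u" and j: "j < length p" "p ! j < p ! 0"
  shows "contains_pattern v p"
proof -
  obtain zs where zs: "subseq zs (u @ v)" "order_isomorphic zs p"
    using assms(1) by (auto simp: contains_pattern_def)
  then obtain xs ys where [simp]: "zs = xs @ ys" and sub: "subseq xs u" "subseq ys v"
    by (auto elim: subseq_appendE)
  have len: "length p = length xs + length ys"
    using zs(2) by (simp add: order_isomorphic_def)
  have set: "set xs \<subseteq> set u" "set ys \<subseteq> set v"
    using sub by (simp_all add: set_subseq)
  have "xs = []"
  proof (rule ccontr)
    assume "xs \<noteq> []"
    have *: "zs ! j < xs ! 0"
      using order_isomorphic_nth_less[OF zs(2), of j 0] j \<open>xs \<noteq> []\<close>
      by (cases p) (simp_all add: nth_append)
    have "xs ! 0 \<in> set u" using set \<open>xs \<noteq> []\<close> by auto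
    have "sorted xs" using sub(1) \<open>sorted u\<close> by (metis sorted_nths subseq_conv_nths)
    show False
    proof (cases "j < length xs")
      case True
      then show False using * \<open>sorted xs\<close> by (auto simp: nth_append dest: sorted_nth_mono[of _ 0 j])
    next
      case False
      then have "zs ! j \<in> set v" using set(2) len j by (auto simp: nth_append)
      then show False using less \<open>xs ! 0 \<in> set u\<close> * by fastforce
    qed
  qed
  then show ?thesis using sub zs by (auto intro: contains_patternI)
qed

lemma not_sorted_subseq:
  fixes u :: "nat list"
  assumes "\<not> sorted u"
  obtains x y where "subseq [x, y] u" "y < x"
  using assms
proof (induction u arbitrary: thesis)
  case (Cons a u)
  show ?case
  proof (cases "sorted u")
    case True
    then obtain y where "y \<in> set u" "y < a" using Cons.prems(2) by auto
    then show thesis using Cons.prems(1)[of a y] by (simp add: subseq_singleton_left)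
  next
    case False
    then obtain x y where "subseq [x, y] u" "y < x" using Cons.IH by blast
    then show thesis using Cons.prems(1) list_emb_Cons by blast
  qed
qed simp

section \<open>Avoidance classes with 231 among the patterns, split at the maximum\<close>

lemma Av_length:
  assumes "w \<in> Av n S"
  shows "length w = n"
  using assms by (auto simp: Av_def permutations_of_set_def dest: distinct_card)

text \<open>The condition on \<open>set u\<close> replaces standardization: the prefix before the
  removed top values is already a permutation of an initial segment.\<close>

lemma Av_subseq:
  assumes "w \<in> Av n S" "subseq u w" "set u = {1..m}"
  shows "u \<in> Av m S"
  using assms contains_pattern_mono[OF _ assms(2)] subseq_distinct[OF assms(2)]
  by (auto simp: Av_def permutations_of_set_def)

lemma AvD:
  assumes "w \<in> Av n S"
  shows "distinct w" "set w = {1..n}"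
  using assms by (auto simp: Av_def permutations_of_set_def)

lemma Av_not_order_isomorphic:
  assumes "w \<in> Av n S" "p \<in> S" "subseq zs w"
  shows "\<not> order_isomorphic zs p"
  using assms by (auto simp: Av_def contains_pattern_def)

text \<open>An entry before \<open>n\<close> that exceeds an entry after \<open>n\<close> would form
  231 together with \<open>n\<close>.\<close>

lemma Av_231_append:
  assumes "u @ n # v \<in> Av n S" "[2,3,1] \<in> S"
  shows "\<forall>x\<in>set u. \<forall>y\<in>set v. x < y"
proof (intro ballI, rule ccontr)
  fix x y assume xy: "x \<in> set u" "y \<in> set v" "\<not> x < y"
  then have "x \<in> {1..n}" "x \<noteq> n" "x \<noteq> y" using AvD[OF assms(1)] by auto
  then have "order_isomorphic [x, n, y] [2,3,1]"
    using xy by (auto simp: order_isomorphic_Nil order_isomorphic_Cons)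
  moreover have "subseq ([x] @ [n, y]) (u @ n # v)"
    using xy by (intro list_emb_append_mono) (auto simp: subseq_singleton_left)
  ultimately show False
    using Av_not_order_isomorphic[OF assms] by simp
qed

lemma Av_231_tail:
  assumes "u @ n # v \<in> Av n S" "[2,3,1] \<in> S"
  shows "set v = {n - length v..<n}"
proof (rule card_subset_eq)
  note perm = AvD[OF assms(1)]
  show "set v \<subseteq> {n - length v..<n}"
  proof
    fix y assume y: "y \<in> set v"
    have "y \<in> {1..n}" "y \<noteq> n" using perm y by auto
    \<comment> \<open>A value between \<open>y\<close> and \<open>n\<close> cannot stand in
      \<open>u\<close>, where all entries are below \<open>y\<close>. Counting these
      \<open>n - y\<close> values bounds \<open>y\<close> from below.\<close>
    have "{y..<n} \<subseteq> set v"
    proof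
      fix x assume "x \<in> {y..<n}"
      then have "x \<in> set (u @ n # v)" "x \<noteq> n" "\<not> x < y"
        using perm \<open>y \<in> {1..n}\<close> by auto
      then show "x \<in> set v" using Av_231_append[OF assms] y by auto
    qed
    then have "card {y..<n} \<le> length v"
      by (meson List.finite_set card_length card_mono le_trans)
    then show "y \<in> {n - length v..<n}" using \<open>y \<in> {1..n}\<close> \<open>y \<noteq> n\<close> by auto
  qed
  have "length v \<le> n" using Av_length[OF assms(1)] by simp
  then show "card (set v) = card {n - length v..<n}"
    using perm by (simp add: distinct_card)
qed simp

lemma Av_231_short_tail:
  assumes "u @ n # v \<in> Av n S" "[2,3,1] \<in> S" "length v \<le> 2"
  shows "v = [] \<or> v = [n - 1] \<or> v = [n - 2, n - 1] \<or> v = [n - 1, n - 2]"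
proof -
  have "length v < n" using Av_length[OF assms(1)] by simp
  note tail = Av_231_tail[OF assms(1,2)]
  \<comment> \<open>The rule \<open>remdups_adj.cases\<close> is borrowed for its split into empty,
    singleton and longer lists.\<close>
  consider "v = []" | x where "v = [x]" | x y where "v = [x, y]"
    using \<open>length v \<le> 2\<close> by (cases v rule: remdups_adj.cases) auto
  then show ?thesis
  proof cases
    case (2 x)
    then have "{x} = {n - 1..<n}" using tail by simp
    also have "\<dots> = {n - 1}" using 2 \<open>length v < n\<close> by auto
    finally show ?thesis using 2 by simp
  next
    case (3 x y)
    then have "{x, y} = {n - 2..<n}" using tail by (simp add: numeral_2_eq_2)
    also have "\<dots> = {n - 2, n - 1}" using 3 \<open>length v < n\<close> by auto
    finally show ?thesis using 3 by (auto simp: doubleton_eq_iff)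
  qed simp
qed

text \<open>The three summands count the tails \<open>[n]\<close>, \<open>[n, n - 1]\<close> and
  \<open>n # c\<close>, the last giving a single permutation. By \<open>late\<close>, appending at
  most two larger values creates no pattern; by \<open>first\<close>, neither does prepending an
  increasing run of smaller values. The parameter \<open>c\<close> is the order of the two values
  after \<open>n\<close>, which differs between the two classes.\<close>

lemma card_Av_231_rec:
  assumes "[2,3,1] \<in> S" "3 \<le> n"
    and late: "\<forall>p\<in>S. \<exists>i. i + 2 < length p \<and> last p < p ! i"
    and first: "\<forall>p\<in>S. \<exists>j<length p. p ! j < p ! 0"
    and c: "distinct c" "set c = {n - 2, n - 1}" "\<forall>p\<in>S. \<not> contains_pattern (n # c) p"
    and tails: "\<And>u v. u @ n # v \<in> Av n S \<Longrightarrow> v = [] \<or> v = [n - 1] \<or> v = c \<and> sorted u"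
  shows "card (Av n S) = card (Av (n - 1) S) + card (Av (n - 2) S) + 1"
proof -
  let ?X = "(\<lambda>u. u @ [n]) ` Av (n - 1) S"
  let ?Y = "(\<lambda>u. u @ [n, n - 1]) ` Av (n - 2) S"
  let ?w = "[1..<n - 2] @ n # c"
  have "length c = 2" using c(1,2) \<open>3 \<le> n\<close> distinct_card[of c] by simp
  \<comment> \<open>Applied below with \<open>v = [n]\<close> and \<open>v = [n, n - 1]\<close>,
    that is, with \<open>m = n - 1\<close> and \<open>m = n - 2\<close>.\<close>
  have short: "u @ v \<in> Av n S"
    if u: "u \<in> Av m S" and v: "set v = {m + 1..n}" "distinct v" "length v \<le> 2" and m: "m \<le> n" for u v m
  proof -
    have perm: "distinct u" "set u = {1..m}" using AvD[OF u] by auto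
    have less: "\<forall>x\<in>set u. \<forall>y\<in>set v. x < y" using perm v by auto
    have "\<not> contains_pattern (u @ v) p" if p: "p \<in> S" for p
    proof
      assume *: "contains_pattern (u @ v) p"
      obtain i where "i + 2 < length p" "last p < p ! i" using late p by blast
      from contains_pattern_append_short[OF * less v(3) this] show False
        using u p by (auto simp: Av_def)
    qed
    then show ?thesis using perm v m by (auto simp: Av_def permutations_of_set_def)
  qed
  have w: "?w \<in> Av n S"
  proof -
    have less: "\<forall>x\<in>set [1..<n - 2]. \<forall>y\<in>set (n # c). x < y" using c by auto
    have "\<not> contains_pattern ?w p" if "p \<in> S" for p
      using contains_pattern_sorted_append[OF _ less] first c(3) that by (metis sorted_upt)
    then show ?thesis using c \<open>3 \<le> n\<close> by (auto simp: Av_def permutations_of_set_def)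
  qed
  have "Av n S = ?X \<union> ?Y \<union> {?w}"
  proof (intro equalityI subsetI)
    fix w assume wA: "w \<in> Av n S"
    then have "n \<in> set w" using AvD(2) \<open>3 \<le> n\<close> by auto
    then obtain u v where [simp]: "w = u @ n # v" by (meson split_list)
    note perm = AvD[OF wA, simplified]
    have set_u: "set u = {1..n} - insert n (set v)" using perm by auto
    consider "v = []" | "v = [n - 1]" | "v = c" "sorted u" using tails[of u v] wA by auto
    then show "w \<in> ?X \<union> ?Y \<union> {?w}"
    proof cases
      case 1
      have "set u = {1..n - 1}" unfolding set_u 1 by auto
      then have "u \<in> Av (n - 1) S" by (intro Av_subseq[OF wA]) auto
      then show ?thesis using 1 by auto
    next
      case 2
      have "set u = {1..n - 2}" unfolding set_u 2 by auto
      then have "u \<in> Av (n - 2) S" by (intro Av_subseq[OF wA]) auto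
      then show ?thesis using 2 by auto
    next
      case 3
      \<comment> \<open>The values of \<open>u\<close> are now determined and \<open>u\<close> is
        sorted, so only one list remains.\<close>
      have "set u = {1..<n - 2}" unfolding set_u 3(1) c(2) by auto
      then have "u = [1..<n - 2]"
        using 3 perm by (metis distinct_upt set_upt sorted_distinct_set_unique sorted_upt)
      then show ?thesis using 3 by simp
    qed
  next
    have "{n, n - 1} = {n - 2 + 1..n}" using \<open>3 \<le> n\<close> by auto
    then have "u @ [n, n - 1] \<in> Av n S" if "u \<in> Av (n - 2) S" for u
      using short[OF that, of "[n, n - 1]"] \<open>3 \<le> n\<close> by auto
    moreover have "u @ [n] \<in> Av n S" if "u \<in> Av (n - 1) S" for u
      using short[OF that, of "[n]"] \<open>3 \<le> n\<close> by auto
    moreover fix w assume "w \<in> ?X \<union> ?Y \<union> {?w}"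
    ultimately show "w \<in> Av n S" using w by auto
  qed
  moreover have "?X \<inter> ?Y = {}" using \<open>3 \<le> n\<close> by auto
  \<comment> \<open>Lists in \<open>?X\<close> and \<open>?Y\<close> have \<open>n\<close> among
    their last two entries, while \<open>?w\<close> ends with the two entries of
    \<open>c\<close>.\<close>
  moreover have "?w \<notin> ?X \<union> ?Y"
  proof -
    obtain a b where "c = [a, b]" using \<open>length c = 2\<close> by (auto simp: numeral_eq_Suc length_Suc_conv)
    then show ?thesis using c(2) \<open>3 \<le> n\<close> by (auto simp: doubleton_eq_iff)
  qed
  moreover have "card ?X = card (Av (n - 1) S)" "card ?Y = card (Av (n - 2) S)"
    by (auto intro!: card_image inj_onI)
  moreover have "finite (Av m S)" for m by (simp add: Av_def)
  ultimately show ?thesis by (simp add: card_Un_disjoint)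
qed

section \<open>Initial values and the Fibonacci numbers\<close>

lemma card_Av_le_2:
  assumes "n \<le> 2" "\<forall>p\<in>S. 3 \<le> length p"
  shows "card (Av n S) = fact n"
proof -
  have "Av n S = permutations_of_set {1..n}"
    using assms contains_pattern_length_le
    by (fastforce simp: Av_def dest: length_finite_permutations_of_set)
  then show ?thesis by simp
qed

text \<open>The recurrence fits since (F n - 1) + (F (n - 1) - 1) + 1 = F (n + 1) - 1. The initial
  values 1 and 2 are F 2 - 1 and F 3 - 1.\<close>

lemma card_Av_eq_F:
  assumes rec: "\<And>n. 3 \<le> n \<Longrightarrow> card (Av n S) = card (Av (n - 1) S) + card (Av (n - 2) S) + 1"
    and "\<forall>p\<in>S. 3 \<le> length p" "n \<ge> 1"
  shows "card (Av n S) = F (n + 1) - 1"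
  using \<open>n \<ge> 1\<close>
proof (induction n rule: less_induct)
  case (less n)
  show ?case
  proof (cases "3 \<le> n")
    case True
    \<comment> \<open>Three successors allow \<open>F\<close> to unfold down to \<open>F m\<close>
      and \<open>F (Suc m)\<close>, whose positivity makes the subtractions exact.\<close>
    then obtain m where "n = Suc (Suc (Suc m))" by (metis numeral_3_eq_3 le_Suc_ex add_Suc)
    then show ?thesis
      using rec[OF True] less.IH[of "n - 1"] less.IH[of "n - 2"] F_pos[of m] F_pos[of "Suc m"] by simp
  next
    case False
    then have "n = 1 \<or> n = 2" using less.prems by auto
    then show ?thesis using card_Av_le_2[OF _ assms(2), of n] by (auto simp: numeral_eq_Suc)
  qed
qed

section \<open>The possible tails after the maximum in the two classes\<close>

lemma length_le_2_if_no_triple: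
  assumes "\<And>x y z. \<not> subseq [x, y, z] v"
  shows "length v \<le> 2"
proof (rule ccontr)
  assume "\<not> length v \<le> 2"
  then obtain x y z v' where "v = x # y # z # v'"
    by (metis One_nat_def Suc_1 Suc_le_length_iff not_less_eq_eq)
  then show False using assms[of x y z] by simp
qed

text \<open>A descent \<open>x\<close>, \<open>y\<close> in \<open>u\<close>, followed by
  \<open>n\<close> and all of \<open>v\<close>, is an occurrence of \<open>p\<close>: the entries of
  \<open>u\<close> lie below those of \<open>v\<close>, which supplies the premise of
  \<open>iso\<close>.\<close>

lemma Av_sorted_prefix:
  assumes "u @ n # v \<in> Av n S" "[2,3,1] \<in> S" "p \<in> S"
    and iso: "\<And>x y. y < x \<Longrightarrow> \<forall>z\<in>set v. x < z \<Longrightarrow> order_isomorphic (x # y # n # v) p"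
  shows "sorted u"
proof (rule ccontr)
  assume "\<not> sorted u"
  then obtain x y where xy: "subseq [x, y] u" "y < x" by (rule not_sorted_subseq)
  then have "\<forall>z\<in>set v. x < z" using Av_231_append[OF assms(1,2)] set_subseq by fastforce
  moreover have "subseq ([x, y] @ n # v) (u @ n # v)" using xy by (intro list_emb_append_mono) auto
  ultimately show False
    using Av_not_order_isomorphic[OF assms(1,3), of "x # y # n # v"] iso[of y x] xy(2) by simp
qed

text \<open>Avoiding 312 makes \<open>v\<close> decreasing, after which 4321 leaves room for at most
  two entries. With two entries, a descent in \<open>u\<close> would complete 21543.\<close>

lemma tails_312_4321_21543:
  assumes w: "u @ n # v \<in> Av n S" and S: "{[2,3,1], [3,1,2], [4,3,2,1], [2,1,5,4,3]} \<subseteq> S"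
  shows "v = [] \<or> v = [n - 1] \<or> v = [n - 1, n - 2] \<and> sorted u"
proof -
  note perm = AvD[OF w]
  have desc: "y < x" if "subseq [x, y] v" for x y
  proof (rule ccontr)
    assume "\<not> y < x"
    have "x \<in> set v" "y \<in> set v" "x \<noteq> y"
      using set_subseq[OF that] perm subseq_distinct[OF that] by auto
    then have "x < n" "y < n" "x < y" using perm \<open>\<not> y < x\<close> by (auto simp: set_eq_iff nat_less_le)
    then have "order_isomorphic [n, x, y] [3,1,2]"
      by (auto simp: order_isomorphic_Nil order_isomorphic_Cons)
    moreover have "subseq [n, x, y] (u @ n # v)" using that by (simp add: subseq_drop_many)
    ultimately show False using Av_not_order_isomorphic[OF w] S by auto
  qed
  have "\<not> subseq [x, y, z] v" for x y z
  proof
    assume *: "subseq [x, y, z] v"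
    have "subseq [x, y] [x, y, z]" "subseq [y, z] [x, y, z]" by auto
    then have "y < x" "z < y" using desc * subseq_order.trans by blast+
    moreover have "x < n" using set_subseq[OF *] perm by (auto simp: set_eq_iff nat_less_le)
    ultimately have "order_isomorphic [n, x, y, z] [4,3,2,1]"
      by (auto simp: order_isomorphic_Nil order_isomorphic_Cons)
    moreover have "subseq [n, x, y, z] (u @ n # v)" using * by (simp add: subseq_drop_many)
    ultimately show False using Av_not_order_isomorphic[OF w] S by auto
  qed
  then have "v = [] \<or> v = [n - 1] \<or> v = [n - 2, n - 1] \<or> v = [n - 1, n - 2]"
    using Av_231_short_tail[OF w] length_le_2_if_no_triple S by auto
  moreover have "v \<noteq> [n - 2, n - 1]" using desc[of "n - 2" "n - 1"] by auto
  moreover have "sorted u" if "v = [n - 1, n - 2]"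
  proof (rule Av_sorted_prefix[OF w])
    \<comment> \<open>This keeps \<open>n\<close>, \<open>n - 1\<close>, \<open>n - 2\<close>
      distinct despite truncated subtraction.\<close>
    have "3 \<le> n" using Av_length[OF w] that by simp
    then show "order_isomorphic (x # y # n # v) [2,1,5,4,3]"
      if "y < x" "\<forall>z\<in>set v. x < z" for x y
      using that \<open>v = [n - 1, n - 2]\<close>
      by (auto simp: order_isomorphic_Nil order_isomorphic_Cons)
  qed (use S in auto)
  ultimately show ?thesis by blast
qed

text \<open>Here 321 makes \<open>v\<close> increasing, 4123 bounds its length by two, and 21534
  rules out a descent in \<open>u\<close> before a tail of two entries.\<close>

lemma tails_321_4123_21534:
  assumes w: "u @ n # v \<in> Av n S" and S: "{[2,3,1], [3,2,1], [4,1,2,3], [2,1,5,3,4]} \<subseteq> S"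
  shows "v = [] \<or> v = [n - 1] \<or> v = [n - 2, n - 1] \<and> sorted u"
proof -
  note perm = AvD[OF w]
  have asc: "x < y" if "subseq [x, y] v" for x y
  proof (rule ccontr)
    assume "\<not> x < y"
    have "x \<in> set v" "y \<in> set v" "x \<noteq> y"
      using set_subseq[OF that] perm subseq_distinct[OF that] by auto
    then have "x < n" "y < n" "y < x" using perm \<open>\<not> x < y\<close> by (auto simp: set_eq_iff nat_less_le)
    then have "order_isomorphic [n, x, y] [3,2,1]"
      by (auto simp: order_isomorphic_Nil order_isomorphic_Cons)
    moreover have "subseq [n, x, y] (u @ n # v)" using that by (simp add: subseq_drop_many)
    ultimately show False using Av_not_order_isomorphic[OF w] S by auto
  qed
  have "\<not> subseq [x, y, z] v" for x y z
  proof
    assume *: "subseq [x, y, z] v"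
    have "subseq [x, y] [x, y, z]" "subseq [y, z] [x, y, z]" by auto
    then have "x < y" "y < z" using asc * subseq_order.trans by blast+
    moreover have "z < n" using set_subseq[OF *] perm by (auto simp: set_eq_iff nat_less_le)
    ultimately have "order_isomorphic [n, x, y, z] [4,1,2,3]"
      by (auto simp: order_isomorphic_Nil order_isomorphic_Cons)
    moreover have "subseq [n, x, y, z] (u @ n # v)" using * by (simp add: subseq_drop_many)
    ultimately show False using Av_not_order_isomorphic[OF w] S by auto
  qed
  then have "v = [] \<or> v = [n - 1] \<or> v = [n - 2, n - 1] \<or> v = [n - 1, n - 2]"
    using Av_231_short_tail[OF w] length_le_2_if_no_triple S by auto
  moreover have "v \<noteq> [n - 1, n - 2]" using asc[of "n - 1" "n - 2"] by auto
  moreover have "sorted u" if "v = [n - 2, n - 1]"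
  proof (rule Av_sorted_prefix[OF w])
    have "3 \<le> n" using Av_length[OF w] that by simp
    then show "order_isomorphic (x # y # n # v) [2,1,5,3,4]"
      if "y < x" "\<forall>z\<in>set v. x < z" for x y
      using that \<open>v = [n - 2, n - 1]\<close>
      by (auto simp: order_isomorphic_Nil order_isomorphic_Cons)
  qed (use S in auto)
  ultimately show ?thesis by blast
qed

theorem theorem2p4:
  fixes n :: nat and A\<^sub>1 A\<^sub>2 :: "nat list set"
  defines "A\<^sub>1 \<equiv> {[2,3,1], [3,1,2], [4,3,2,1], [2,1,5,4,3]}"
    and "A\<^sub>2 \<equiv> {[2,3,1], [3,2,1], [4,1,2,3], [2,1,5,3,4]}"
  assumes "n \<ge> 1"
  shows "card (Av n A\<^sub>1) = card (Av n A\<^sub>2) \<and> card (Av n A\<^sub>2) = F (n + 1) - 1"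
proof -
  have late: "\<exists>i. i + 2 < length p \<and> last p < p ! i" if "p \<in> A\<^sub>1 \<union> A\<^sub>2" for p
  proof -
    \<comment> \<open>Position 0 works for the patterns of length 3 and 4; in those of length 5,
      position 2 holds the entry 5.\<close>
    have "0 + 2 < length p \<and> last p < p ! 0 \<or> 2 + 2 < length p \<and> last p < p ! 2"
      using that by (auto simp: A\<^sub>1_def A\<^sub>2_def)
    then show ?thesis by blast
  qed
  have first: "\<exists>j<length p. p ! j < p ! 0" if "p \<in> A\<^sub>1 \<union> A\<^sub>2" for p
  proof -
    \<comment> \<open>Every pattern starts with a descent except 231, where position 2
      serves.\<close>
    have "1 < length p \<and> p ! 1 < p ! 0 \<or> 2 < length p \<and> p ! 2 < p ! 0"
      using that by (auto simp: A\<^sub>1_def A\<^sub>2_def)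
    then show ?thesis by blast
  qed
  have "card (Av n A\<^sub>1) = F (n + 1) - 1"
  proof (rule card_Av_eq_F)
    fix m :: nat assume "3 \<le> m"
    show "card (Av m A\<^sub>1) = card (Av (m - 1) A\<^sub>1) + card (Av (m - 2) A\<^sub>1) + 1"
    proof (rule card_Av_231_rec[where c = "[m - 1, m - 2]"])
      show "\<forall>p\<in>A\<^sub>1. \<not> contains_pattern (m # [m - 1, m - 2]) p"
      proof (intro ballI notI)
        fix p assume p: "p \<in> A\<^sub>1" "contains_pattern (m # [m - 1, m - 2]) p"
        \<comment> \<open>A list of length 3 can contain only the short patterns, and then as a
          whole; but this list is order isomorphic to 321.\<close>
        then have "p \<in> {[2,3,1], [3,1,2]}"
          using contains_pattern_length_le[OF p(2)] by (auto simp: A\<^sub>1_def)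
        moreover from this have "order_isomorphic (m # [m - 1, m - 2]) p"
          using contains_pattern_same_length[OF p(2)] by auto
        ultimately show False
          using \<open>3 \<le> m\<close> by (auto simp: order_isomorphic_Nil order_isomorphic_Cons)
      qed
      show "v = [] \<or> v = [m - 1] \<or> v = [m - 1, m - 2] \<and> sorted u" if "u @ m # v \<in> Av m A\<^sub>1" for u v
        using tails_312_4321_21543[OF that] by (simp add: A\<^sub>1_def)
      show "\<forall>p\<in>A\<^sub>1. \<exists>i. i + 2 < length p \<and> last p < p ! i"
        "\<forall>p\<in>A\<^sub>1. \<exists>j<length p. p ! j < p ! 0"
        using late first by blast+
    qed (use \<open>3 \<le> m\<close> in \<open>auto simp: A\<^sub>1_def\<close>)
  qed (use \<open>n \<ge> 1\<close> in \<open>auto simp: A\<^sub>1_def\<close>)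
  moreover have "card (Av n A\<^sub>2) = F (n + 1) - 1"
  proof (rule card_Av_eq_F)
    fix m :: nat assume "3 \<le> m"
    show "card (Av m A\<^sub>2) = card (Av (m - 1) A\<^sub>2) + card (Av (m - 2) A\<^sub>2) + 1"
    proof (rule card_Av_231_rec[where c = "[m - 2, m - 1]"])
      show "\<forall>p\<in>A\<^sub>2. \<not> contains_pattern (m # [m - 2, m - 1]) p"
      proof (intro ballI notI)
        fix p assume p: "p \<in> A\<^sub>2" "contains_pattern (m # [m - 2, m - 1]) p"
        \<comment> \<open>This time the list is order isomorphic to 312, which differs from both
          short patterns.\<close>
        then have "p \<in> {[2,3,1], [3,2,1]}"
          using contains_pattern_length_le[OF p(2)] by (auto simp: A\<^sub>2_def)
        moreover from this have "order_isomorphic (m # [m - 2, m - 1]) p"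
          using contains_pattern_same_length[OF p(2)] by auto
        ultimately show False
          using \<open>3 \<le> m\<close> by (auto simp: order_isomorphic_Nil order_isomorphic_Cons)
      qed
      show "v = [] \<or> v = [m - 1] \<or> v = [m - 2, m - 1] \<and> sorted u" if "u @ m # v \<in> Av m A\<^sub>2" for u v
        using tails_321_4123_21534[OF that] by (simp add: A\<^sub>2_def)
      show "\<forall>p\<in>A\<^sub>2. \<exists>i. i + 2 < length p \<and> last p < p ! i"
        "\<forall>p\<in>A\<^sub>2. \<exists>j<length p. p ! j < p ! 0"
        using late first by blast+
    qed (use \<open>3 \<le> m\<close> in \<open>auto simp: A\<^sub>2_def\<close>)
  qed (use \<open>n \<ge> 1\<close> in \<open>auto simp: A\<^sub>2_def\<close>)
  ultimately show ?thesis by simp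
qed

end
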